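(* Let $K$ be a field, let $S=K[X_1,\ldots,X_n]$, and let $I\subset S$ be a nonzero proper stable monomial ideal. Then the Taylor resolution of $I$ is minimal if and only if $I$ is of the following form: $I=(u_1,\ldots,u_r)$ for some $1\le r\leq n$, where $$u_i = X_i\cdot\prod_{k=1}^{i}X_k^{a_k}\qquad (i=1,\ldots,r)$$ for some integers $a_1,\ldots,a_r\geq 0$.
   Context: For a monomial $u\ne 1$ in $S=K[X_1,\ldots,X_n]$, let $m(u)=\max\{j : X_j \text{ divides } u\}$. A monomial ideal $I\subset S$ is stable if for every monomial $w\in I$ one has $X_i w/X_{m(w)}\in I$ for all $i<m(w)$. For a monomial ideal $I\subset S$, let $G(I)=\{v_1,\ldots,v_t\}$ be its minimal set of monomial generators. The Taylor resolution $(T_\bullet(I),d_\bullet)$ of $I$: let $L$ be the free $S$-module with basis $e_1,\ldots,e_t$; set $T_q(I)=\bigwedge^{q+1}L$ for $q=0,\ldots,t-1$; for $q=1,\ldots,t-1$ the map $d_q:T_q(I)\to T_{q-1}(I)$ is $$d_q(e_{i_0}\wedge\cdots\wedge e_{i_q})=\sum_{s=0}^{q}(-1)^s\frac{\mathrm{lcm}(v_{i_0},\ldots,v_{i_q})}{\mathrm{lcm}(v_{i_0},\ldots,\check{v}_{i_s},\ldots,v_{i_q})}\, e_{i_0}\wedge\cdots\check{e}_{i_s}\cdots\wedge e_{i_q},$$ where $\check{\ }$ denotes omission, and the augmentation $\epsilon:T_0(I)\to I$ is $\epsilon(e_i)=v_i$. This is a free resolution of $I$; it is minimal if it is a minimal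 (multigraded) free resolution, i.e. $d_q(T_q(I))\subseteq (X_1,\ldots,X_n)T_{q-1}(I)$ for all $q\ge 1$. *)

theory Defs
  imports "HOL-Library.Poly_Mapping" "HOL-Algebra.Ideal"
begin

text \<open>
  A monomial is given by its exponent vector \<open>w\<close>, where \<open>lookup w j\<close> is the exponent of \<open>X\<^sub>j\<close>;
  thus the product of monomials is the sum of exponent vectors, the monomial 1 is the
  vector \<open>0\<close>, and \<open>w - u\<close> is the quotient whenever \<open>u\<close> divides \<open>w\<close>.
\<close>

type_synonym expo = "nat \<Rightarrow>\<^sub>0 nat"
type_synonym 'k mpoly = "expo \<Rightarrow>\<^sub>0 'k"

definition monom :: "expo \<Rightarrow> 'k::field mpoly"
  where "monom w = Poly_Mapping.single w 1"

definition X :: "nat \<Rightarrow> 'k::field mpoly"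
  where "X i = monom (Poly_Mapping.single i 1)"

definition expos :: "nat \<Rightarrow> expo set"
  where "expos n = {w. Poly_Mapping.keys w \<subseteq> {1..n}}"

text \<open>The ring \<open>K[X\<^sub>1, \<dots>, X\<^sub>n]\<close>; the type alone provides variables \<open>X\<^sub>j\<close> for every natural \<open>j\<close>.\<close>

definition poly_ring :: "nat \<Rightarrow> 'k::field mpoly ring"
  where "poly_ring n =
    \<lparr>carrier = {p. Poly_Mapping.keys p \<subseteq> expos n}, mult = (*), one = 1, zero = 0, add = (+)\<rparr>"

lemma expos_add: "u \<in> expos n \<Longrightarrow> w \<in> expos n \<Longrightarrow> u + w \<in> expos n"
  using Poly_Mapping.keys_add[of u w] by (auto simp: expos_def)

lemma cring_poly_ring: "cring (poly_ring n :: 'k::field mpoly ring)"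
proof (rule cringI)
  show "abelian_group (poly_ring n :: 'k mpoly ring)"
  proof (rule abelian_groupI)
    fix p :: "'k mpoly" assume "p \<in> carrier (poly_ring n)"
    then have "- p \<in> carrier (poly_ring n)"
      by (simp add: poly_ring_def)
    then show "\<exists>q\<in>carrier (poly_ring n). q \<oplus>\<^bsub>poly_ring n\<^esub> p = \<zero>\<^bsub>poly_ring n\<^esub>"
      by (intro bexI[of _ "- p"]) (simp_all add: poly_ring_def)
  next
    fix p q :: "'k mpoly"
    assume "p \<in> carrier (poly_ring n)" "q \<in> carrier (poly_ring n)"
    then show "p \<oplus>\<^bsub>poly_ring n\<^esub> q \<in> carrier (poly_ring n)"
      using Poly_Mapping.keys_add[of p q] by (auto simp: poly_ring_def)
  qed (auto simp: poly_ring_def algebra_simps)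
  show "comm_monoid (poly_ring n :: 'k mpoly ring)"
  proof (rule comm_monoidI)
    fix p q :: "'k mpoly"
    assume "p \<in> carrier (poly_ring n)" "q \<in> carrier (poly_ring n)"
    then show "p \<otimes>\<^bsub>poly_ring n\<^esub> q \<in> carrier (poly_ring n)"
      using keys_mult[of p q] expos_add by (fastforce simp: poly_ring_def)
  qed (auto simp: poly_ring_def expos_def algebra_simps)
qed (auto simp: poly_ring_def algebra_simps)

definition monomial_ideal :: "nat \<Rightarrow> 'k::field mpoly set \<Rightarrow> bool"
  where "monomial_ideal n I \<longleftrightarrow> (\<exists>A \<subseteq> expos n. I = Idl\<^bsub>poly_ring n\<^esub> (monom ` A))"

definition max_var :: "expo \<Rightarrow> nat"
  where "max_var w = Max (Poly_Mapping.keys w)"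

definition stable_ideal :: "nat \<Rightarrow> 'k::field mpoly set \<Rightarrow> bool"
  where "stable_ideal n I \<longleftrightarrow>
    (\<forall>w \<in> expos n. w \<noteq> 0 \<longrightarrow> monom w \<in> I \<longrightarrow>
      (\<forall>i. 1 \<le> i \<and> i < max_var w \<longrightarrow>
        monom (Poly_Mapping.single i 1 + w - Poly_Mapping.single (max_var w) 1) \<in> I))"

definition minimal_monomial_generators :: "nat \<Rightarrow> 'k::field mpoly set \<Rightarrow> expo set \<Rightarrow> bool"
  where "minimal_monomial_generators n I G \<longleftrightarrow>
    G \<subseteq> expos n \<and> Idl\<^bsub>poly_ring n\<^esub> (monom ` G) = I \<and>
    (\<forall>H. H \<subset> G \<longrightarrow> Idl\<^bsub>poly_ring n\<^esub> (monom ` H) \<noteq> I)"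

text \<open>The least common multiple of a finite set of monomials, the empty lcm being 1.\<close>

definition lcm_expo :: "expo set \<Rightarrow> expo"
  where "lcm_expo A =
    (\<Sum>k\<in>(\<Union>w\<in>A. Poly_Mapping.keys w).
      Poly_Mapping.single k (Max ((\<lambda>w. Poly_Mapping.lookup w k) ` A)))"

lemma lookup_lcm_expo:
  assumes "finite A" "A \<noteq> {}"
  shows "Poly_Mapping.lookup (lcm_expo A) k = Max ((\<lambda>w. Poly_Mapping.lookup w k) ` A)"
proof (cases "k \<in> (\<Union>w\<in>A. Poly_Mapping.keys w)")
  case True
  then show ?thesis
    using assms by (simp add: lcm_expo_def lookup_sum lookup_single when_def)
next
  case False
  then have "(\<lambda>w. Poly_Mapping.lookup w k) ` A = {0}"
    using assms(2) by (auto simp: in_keys_iff)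
  then show ?thesis
    using assms False by (simp add: lcm_expo_def lookup_sum lookup_single when_def)
qed

text \<open>
  The exterior power \<open>\<And>\<^bsup>q+1\<^esup> L\<close> of the free module \<open>L\<close> with basis \<open>e\<^sub>1, \<dots>, e\<^sub>t\<close> is free on the
  elements \<open>e\<^sub>F = e\<^bsub>i\<^sub>0\<^esub> \<and> \<dots> \<and> e\<^bsub>i\<^sub>q\<^esub>\<close> for \<open>F = {i\<^sub>0 < \<dots> < i\<^sub>q} \<subseteq> {1..t}\<close>. An element is
  represented by its family of coordinates, indexed by the sets \<open>F\<close>.
\<close>

definition taylor_indices :: "nat \<Rightarrow> nat \<Rightarrow> nat set set"
  where "taylor_indices t q = {F. F \<subseteq> {1..t} \<and> card F = q + 1}"

definition taylor_module :: "nat \<Rightarrow> nat \<Rightarrow> nat \<Rightarrow> (nat set \<Rightarrow> 'k::field mpoly) set"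
  where "taylor_module n t q =
    {f. (\<forall>F \<in> taylor_indices t q. f F \<in> carrier (poly_ring n)) \<and>
        (\<forall>F. F \<notin> taylor_indices t q \<longrightarrow> f F = 0)}"

definition wedge_basis :: "nat set \<Rightarrow> nat set \<Rightarrow> 'k::field mpoly"
  where "wedge_basis F = (\<lambda>G. if G = F then 1 else 0)"

text \<open>
  The image of \<open>e\<^sub>F\<close>. If \<open>i = i\<^sub>s\<close> in the increasing enumeration of \<open>F\<close>, then
  \<open>s = card {j \<in> F. j < i}\<close>.
\<close>

definition taylor_diff_basis ::
    "(nat \<Rightarrow> expo) \<Rightarrow> nat set \<Rightarrow> nat set \<Rightarrow> 'k::field mpoly"
  where "taylor_diff_basis v F = (\<lambda>G. \<Sum>i\<in>F.
    (- 1) ^ card {j \<in> F. j < i} *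
    monom (lcm_expo (v ` F) - lcm_expo (v ` (F - {i}))) *
    wedge_basis (F - {i}) G)"

definition taylor_diff ::
    "(nat \<Rightarrow> expo) \<Rightarrow> nat \<Rightarrow> nat \<Rightarrow> (nat set \<Rightarrow> 'k::field mpoly) \<Rightarrow> nat set \<Rightarrow> 'k mpoly"
  where "taylor_diff v t q f = (\<lambda>G. \<Sum>F\<in>taylor_indices t q. f F * taylor_diff_basis v F G)"

definition graded_max_ideal :: "nat \<Rightarrow> 'k::field mpoly set"
  where "graded_max_ideal n = Idl\<^bsub>poly_ring n\<^esub> (X ` {1..n})"

text \<open>The submodule \<open>J T\<close>: all finite sums of products \<open>a g\<close> with \<open>a \<in> J\<close> and \<open>g \<in> T\<close>.\<close>

definition ideal_module_prod ::
    "'k::field mpoly set \<Rightarrow> (nat set \<Rightarrow> 'k mpoly) set \<Rightarrow> (nat set \<Rightarrow> 'k mpoly) set"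
  where "ideal_module_prod J T =
    {f. \<exists>(N::nat) a g. (\<forall>j<N. a j \<in> J \<and> g j \<in> T) \<and> f = (\<lambda>F. \<Sum>j<N. a j * g j F)}"

text \<open>
  Minimality of the Taylor resolution on \<open>v\<^sub>1, \<dots>, v\<^sub>t\<close>. The coefficient field occurs only in
  the types, hence the type argument.
\<close>

definition taylor_resolution_minimal :: "'k::field itself \<Rightarrow> nat \<Rightarrow> nat \<Rightarrow> (nat \<Rightarrow> expo) \<Rightarrow> bool"
  where "taylor_resolution_minimal _ n t v \<longleftrightarrow>
    (\<forall>q \<in> {1..t-1}. taylor_diff v t q ` (taylor_module n t q :: (nat set \<Rightarrow> 'k mpoly) set)
      \<subseteq> ideal_module_prod (graded_max_ideal n) (taylor_module n t (q - 1)))"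

end

theory Submission imports Defs begin

text \<open>
  A coefficient of the Taylor differential is a unit exactly when omitting a generator \<open>u\<close> does not
  change an lcm. Testing this on the lcm of all generators, minimality says that every generator
  \<open>u\<close> has a variable in which its exponent exceeds that of all the others.

  If the ideal is stable, then for a minimal generator \<open>u\<close> and \<open>i < m(u)\<close> a minimal generator \<open>w\<close>
  dividing \<open>X\<^sub>i u / X\<^bsub>m(u)\<^esub>\<close> has \<open>X\<^sub>i\<close>-exponent one more than that of \<open>u\<close> and no larger exponent than
  \<open>u\<close> elsewhere. Hence the distinguished variable of any generator \<open>u\<close> can only be its last one, and
  \<open>m(w) = i\<close>. So \<open>m\<close> maps the generators bijectively onto some \<open>{1..r}\<close>, and the
  exponents of \<open>X\<^sub>i\<close> in the generators with \<open>m > i\<close> all equal the one in the \<open>i\<close>-th generator minus 1.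
\<close>

section \<open>Ideals generated by monomials\<close>

text \<open>The monomials of the ideal generated by \<open>A\<close>. Statements about ideals are
  reduced to these sets, in which the coefficient field no longer occurs.\<close>

definition multiples :: "nat \<Rightarrow> expo set \<Rightarrow> expo set"
  where "multiples n A =
    {w \<in> expos n. \<exists>a\<in>A. \<forall>k. Poly_Mapping.lookup a k \<le> Poly_Mapping.lookup w k}"

lemma expos_diff: "u \<in> expos n \<Longrightarrow> u - w \<in> expos n"
  by (auto simp: expos_def in_keys_iff lookup_minus subset_iff)

lemma multiplesE:
  assumes "w \<in> multiples n A"
  obtains a where "w \<in> expos n" "a \<in> A"
    "\<forall>k. Poly_Mapping.lookup a k \<le> Poly_Mapping.lookup w k"
  using assms unfolding multiples_def by blast

lemma multiples_add:
  assumes "u \<in> expos n" "w \<in> multiples n A"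
  shows "u + w \<in> multiples n A"
proof -
  obtain a where a: "w \<in> expos n" "a \<in> A"
    "\<forall>k. Poly_Mapping.lookup a k \<le> Poly_Mapping.lookup w k"
    using assms(2) by (rule multiplesE)
  then have "\<forall>k. Poly_Mapping.lookup a k \<le> Poly_Mapping.lookup (u + w) k"
    by (simp add: lookup_add trans_le_add2)
  then show ?thesis
    using a expos_add[OF assms(1) a(1)] unfolding multiples_def by blast
qed

lemma multiples_self: "A \<subseteq> expos n \<Longrightarrow> a \<in> A \<Longrightarrow> a \<in> multiples n A"
  unfolding multiples_def by blast

lemma keys_monom [simp]: "Poly_Mapping.keys (monom w :: 'k::field mpoly) = {w}"
  by (simp add: monom_def)

lemma monom_add: "monom (u + w) = monom u * monom w"
  by (simp add: monom_def mult_single)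

lemma sum_single_keys: "(\<Sum>w\<in>Poly_Mapping.keys p. Poly_Mapping.single w (Poly_Mapping.lookup p w)) = p"
  by (rule poly_mapping_eqI) (auto simp: lookup_sum lookup_single when_def in_keys_iff)

lemma a_inv_poly_ring:
  assumes "(p :: 'k::field mpoly) \<in> carrier (poly_ring n)"
  shows "\<ominus>\<^bsub>poly_ring n\<^esub> p = - p"
proof -
  interpret cring "poly_ring n :: 'k mpoly ring" by (rule cring_poly_ring)
  show ?thesis
    by (rule minus_equality) (use assms in \<open>auto simp: poly_ring_def\<close>)
qed

text \<open>The support of a sum lies in the union of the supports, that of a product in their
  sumset, and \<open>multiples n A\<close> absorbs addition of exponent vectors.\<close>

lemma ideal_keys_subset_multiples:
  "ideal {p :: 'k::field mpoly. Poly_Mapping.keys p \<subseteq> multiples n A} (poly_ring n)"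
    (is "ideal ?J _")
proof -
  interpret cring "poly_ring n :: 'k mpoly ring" by (rule cring_poly_ring)
  have sub: "p \<in> carrier (poly_ring n)" if "p \<in> ?J" for p
    using that by (auto simp: poly_ring_def multiples_def)
  have mult: "x * p \<in> ?J" if "p \<in> ?J" "x \<in> carrier (poly_ring n)" for p x
    using that keys_mult[of x p] multiples_add by (fastforce simp: poly_ring_def)
  show ?thesis
  proof (rule idealI)
    show "subgroup ?J (add_monoid (poly_ring n))"
    proof (rule add.subgroupI)
      fix p q assume pq: "p \<in> ?J" "q \<in> ?J"
      show "p \<oplus>\<^bsub>poly_ring n\<^esub> q \<in> ?J"
        using pq Poly_Mapping.keys_add[of p q] by (auto simp: poly_ring_def)
    next
      fix p assume "p \<in> ?J"
      then show "\<ominus>\<^bsub>poly_ring n\<^esub> p \<in> ?J"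
        using a_inv_poly_ring[OF sub] by simp
    next
      have "0 \<in> ?J" by simp
      then show "?J \<noteq> {}" by blast
    qed (use sub in blast)
  next
    fix p x :: "'k mpoly" assume "p \<in> ?J" "x \<in> carrier (poly_ring n)"
    then show "x \<otimes>\<^bsub>poly_ring n\<^esub> p \<in> ?J" "p \<otimes>\<^bsub>poly_ring n\<^esub> x \<in> ?J"
      using mult[of p x] by (auto simp: poly_ring_def mult.commute)
  qed (rule ring_axioms)
qed

text \<open>The right-hand side is an ideal containing the generators. Conversely, a polynomial is
  the sum of its terms, and each term here is a multiple of a generator.\<close>

lemma Idl_monom:
  assumes "A \<subseteq> expos n"
  shows "Idl\<^bsub>poly_ring n\<^esub> (monom ` A :: 'k::field mpoly set) =
    {p. Poly_Mapping.keys p \<subseteq> multiples n A}" (is "?I = ?J")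
proof -
  interpret cring "poly_ring n :: 'k mpoly ring" by (rule cring_poly_ring)
  have gens: "monom ` A \<subseteq> carrier (poly_ring n :: 'k mpoly ring)"
    using assms by (auto simp: poly_ring_def)
  interpret I: ideal ?I "poly_ring n :: 'k mpoly ring"
    by (rule genideal_ideal[OF gens])
  show ?thesis
  proof
    have "monom ` A \<subseteq> ?J"
      using assms by (auto simp: multiples_def)
    then show "?I \<subseteq> ?J"
      by (intro genideal_minimal ideal_keys_subset_multiples)
  next
    have single: "Poly_Mapping.single w c \<in> ?I" if w: "w \<in> multiples n A" for w and c :: 'k
    proof -
      obtain a where a: "a \<in> A" "\<forall>k. Poly_Mapping.lookup a k \<le> Poly_Mapping.lookup w k"
        using w unfolding multiples_def by blast
      have "Poly_Mapping.single w c = Poly_Mapping.single (w - a) c * monom a"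
      proof -
        \<comment> \<open>The truncated subtraction is exact because \<open>a\<close> divides
          \<open>w\<close>.\<close>
        have "w - a + a = w"
          by (rule poly_mapping_eqI) (use a in \<open>simp add: lookup_add lookup_minus\<close>)
        then show ?thesis by (simp add: monom_def mult_single)
      qed
      moreover have "Poly_Mapping.single (w - a) c \<in> carrier (poly_ring n)"
        using w expos_diff[of w n a] by (auto simp: multiples_def poly_ring_def)
      moreover have "monom a \<in> ?I"
        using genideal_self[OF gens] a(1) by blast
      ultimately show ?thesis
        using I.I_l_closed by (fastforce simp: poly_ring_def)
    qed
    have sum: "(\<Sum>w\<in>W. Poly_Mapping.single w (c w)) \<in> ?I"
      if "finite W" "W \<subseteq> multiples n A" for W and c :: "expo \<Rightarrow> 'k"
      using that
    proof (induction W)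
      case empty
      then show ?case using I.zero_closed by (simp add: poly_ring_def)
    next
      case (insert w W)
      then show ?case
        using I.a_closed[OF single[of w "c w"] insert.IH] by (simp add: poly_ring_def)
    qed
    show "?J \<subseteq> ?I"
    proof
      fix p assume "p \<in> ?J"
      then show "p \<in> ?I"
        using sum[of "Poly_Mapping.keys p" "Poly_Mapping.lookup p"] by (simp add: sum_single_keys)
    qed
  qed
qed

lemma monom_in_Idl_iff:
  assumes "A \<subseteq> expos n"
  shows "(monom w :: 'k::field mpoly) \<in> Idl\<^bsub>poly_ring n\<^esub> (monom ` A) \<longleftrightarrow> w \<in> multiples n A"
  using assms by (simp add: Idl_monom)

lemma Idl_monom_eq_iff:
  assumes "A \<subseteq> expos n" "B \<subseteq> expos n"
  shows "Idl\<^bsub>poly_ring n\<^esub> (monom ` A) = (Idl\<^bsub>poly_ring n\<^esub> (monom ` B) :: 'k::field mpoly set) \<longleftrightarrow>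
    multiples n A = multiples n B"
    (is "?I = ?J \<longleftrightarrow> _")
proof
  assume IJ: "?I = ?J"
  show "multiples n A = multiples n B"
  proof (rule Set.set_eqI)
    fix w
    show "w \<in> multiples n A \<longleftrightarrow> w \<in> multiples n B"
      unfolding monom_in_Idl_iff[OF assms(1), where 'k='k, symmetric]
        monom_in_Idl_iff[OF assms(2), where 'k='k, symmetric] IJ ..
  qed
next
  assume "multiples n A = multiples n B"
  then show "?I = ?J" by (simp only: Idl_monom[OF assms(1)] Idl_monom[OF assms(2)])
qed

section \<open>Divisibility antichains and uniqueness of minimal monomial generators\<close>

definition antichain :: "expo set \<Rightarrow> bool"
  where "antichain A \<longleftrightarrow>
    (\<forall>a\<in>A. \<forall>b\<in>A. (\<forall>k. Poly_Mapping.lookup a k \<le> Poly_Mapping.lookup b k) \<longrightarrow> a = b)"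

text \<open>If \<open>a\<close> properly divides \<open>b\<close>, then every multiple of
  \<open>b\<close> is a multiple of \<open>a\<close>, so \<open>b\<close> could be dropped from the
  generators.\<close>

lemma antichain_minimal_monomial_generators:
  assumes "minimal_monomial_generators n (I :: 'k::field mpoly set) G"
  shows "antichain G"
  unfolding antichain_def
proof (intro ballI impI, rule ccontr)
  fix a b assume ab: "a \<in> G" "b \<in> G" "a \<noteq> b"
    and le: "\<forall>k. Poly_Mapping.lookup a k \<le> Poly_Mapping.lookup b k"
  have G: "G \<subseteq> expos n" "Idl\<^bsub>poly_ring n\<^esub> (monom ` G) = I"
    "\<And>H. H \<subset> G \<Longrightarrow> Idl\<^bsub>poly_ring n\<^esub> (monom ` H) \<noteq> I"
    using assms by (auto simp: minimal_monomial_generators_def)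
  have "multiples n (G - {b}) = multiples n G"
  proof
    show "multiples n (G - {b}) \<subseteq> multiples n G" by (auto simp: multiples_def)
    show "multiples n G \<subseteq> multiples n (G - {b})"
    proof
      fix w assume "w \<in> multiples n G"
      then obtain c where c: "w \<in> expos n" "c \<in> G"
        "\<forall>k. Poly_Mapping.lookup c k \<le> Poly_Mapping.lookup w k"
        by (rule multiplesE)
      show "w \<in> multiples n (G - {b})"
      proof (cases "c = b")
        case True
        then have "Poly_Mapping.lookup a k \<le> Poly_Mapping.lookup w k" for k
          using le[rule_format, of k] c(3)[rule_format, of k] True by simp
        then show ?thesis using ab c(1) by (auto simp: multiples_def)
      qed (use c in \<open>auto simp: multiples_def\<close>)
    qed
  qed
  moreover have "G - {b} \<subseteq> expos n" using G(1) by blast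
  ultimately have "Idl\<^bsub>poly_ring n\<^esub> (monom ` (G - {b})) = I"
    using G(1,2) Idl_monom_eq_iff[where 'k='k] by blast
  then show False using G(3)[of "G - {b}"] ab(2) by blast
qed

text \<open>Each \<open>a\<close> in \<open>A\<close> is divisible by some \<open>b\<close> in
  \<open>B\<close>, which is divisible by some \<open>c\<close> in \<open>A\<close>. The antichain
  property gives \<open>c = a\<close>, which squeezes \<open>b\<close> to \<open>a\<close>.\<close>

lemma antichain_subset_if_multiples_eq:
  assumes "antichain A" "A \<subseteq> expos n" "B \<subseteq> expos n" "multiples n A = multiples n B"
  shows "A \<subseteq> B"
proof
  fix a assume a: "a \<in> A"
  then have "a \<in> multiples n B"
    using multiples_self[OF assms(2)] assms(4) by simp
  then obtain b where b: "b \<in> B" "\<forall>k. Poly_Mapping.lookup b k \<le> Poly_Mapping.lookup a k"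
    unfolding multiples_def by blast
  then have "b \<in> multiples n A"
    using multiples_self[OF assms(3)] assms(4) by simp
  then obtain c where c: "c \<in> A" "\<forall>k. Poly_Mapping.lookup c k \<le> Poly_Mapping.lookup b k"
    unfolding multiples_def by blast
  have "Poly_Mapping.lookup c k \<le> Poly_Mapping.lookup a k" for k
    by (rule order_trans[OF c(2)[rule_format] b(2)[rule_format]])
  then have "c = a"
    using a c(1) assms(1) unfolding antichain_def by blast
  then have "Poly_Mapping.lookup a k = Poly_Mapping.lookup b k" for k
    using b(2)[rule_format, of k] c(2)[rule_format, of k] by simp
  then have "a = b" by (rule poly_mapping_eqI)
  then show "a \<in> B" using b by simp
qed

lemma antichain_eq_if_multiples_eq:
  assumes "antichain A" "antichain B" "A \<subseteq> expos n" "B \<subseteq> expos n"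
    "multiples n A = multiples n B"
  shows "A = B"
  using assms antichain_subset_if_multiples_eq by (metis subset_antisym)

section \<open>Minimality of the Taylor resolution\<close>

text \<open>The combinatorial form of minimality: omitting any one of several generators changes the
  lcm, which happens in the variable \<open>k\<close>.\<close>

definition peaked :: "expo set \<Rightarrow> bool"
  where "peaked G \<longleftrightarrow>
    (\<forall>u\<in>G. \<exists>k. \<forall>w\<in>G - {u}. Poly_Mapping.lookup w k < Poly_Mapping.lookup u k)"

lemma peaked_imp_antichain:
  assumes "peaked G"
  shows "antichain G"
  using assms unfolding antichain_def peaked_def
  by (metis DiffI empty_iff insert_iff leD)

section \<open>The maximal ideal and its products with the Taylor modules\<close>

lemma graded_max_ideal_eq:
  "graded_max_ideal n = {p :: 'k::field mpoly. Poly_Mapping.keys p \<subseteq> expos n - {0}}"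
proof -
  have eq: "(X :: nat \<Rightarrow> 'k mpoly) ` {1..n} =
      monom ` ((\<lambda>i. Poly_Mapping.single i 1) ` {1..n})"
    by (auto simp: X_def)
  have sub: "(\<lambda>i. Poly_Mapping.single i 1) ` {1..n} \<subseteq> expos n"
    by (auto simp: expos_def)
  \<comment> \<open>A monomial is different from 1 exactly if some variable divides it, so the ideal
    consists of the polynomials without constant term.\<close>
  have "multiples n ((\<lambda>i. Poly_Mapping.single i 1) ` {1..n}) = expos n - {0}"
  proof
    show "multiples n ((\<lambda>i. Poly_Mapping.single i 1) ` {1..n}) \<subseteq> expos n - {0}"
    proof
      fix w :: expo assume "w \<in> multiples n ((\<lambda>i. Poly_Mapping.single i 1) ` {1..n})"
      then obtain i where w: "w \<in> expos n"
        "\<forall>k. Poly_Mapping.lookup (Poly_Mapping.single i (1::nat)) k \<le> Poly_Mapping.lookup w k"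
        by (auto simp: multiples_def)
      have "1 \<le> Poly_Mapping.lookup w i"
        using w(2)[rule_format, of i] by simp
      then show "w \<in> expos n - {0}" using w(1) by auto
    qed
    show "expos n - {0} \<subseteq> multiples n ((\<lambda>i. Poly_Mapping.single i 1) ` {1..n})"
    proof
      fix w :: expo assume w: "w \<in> expos n - {0}"
      then obtain i where i: "Poly_Mapping.lookup w i \<noteq> 0"
        by (metis DiffD2 insertI1 lookup_zero poly_mapping_eqI)
      then have "i \<in> Poly_Mapping.keys w" by (simp add: in_keys_iff)
      then have "i \<in> {1..n}" using w unfolding expos_def by blast
      then show "w \<in> multiples n ((\<lambda>i. Poly_Mapping.single i 1) ` {1..n})"
        using i w by (auto simp: multiples_def lookup_single when_def intro!: bexI[of _ i])
    qed
  qed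
  then show ?thesis
    unfolding graded_max_ideal_def eq by (simp only: Idl_monom[OF sub])
qed

lemma finite_taylor_indices: "finite (taylor_indices t q)"
  by (rule finite_subset[of _ "Pow {1..t}"]) (auto simp: taylor_indices_def)

lemma keys_sum_subset:
  assumes "\<And>i. i \<in> A \<Longrightarrow> Poly_Mapping.keys (f i) \<subseteq> W"
  shows "Poly_Mapping.keys (sum f A) \<subseteq> W"
proof
  fix w assume "w \<in> Poly_Mapping.keys (sum f A)"
  then have "(\<Sum>i\<in>A. Poly_Mapping.lookup (f i) w) \<noteq> 0"
    by (simp add: in_keys_iff lookup_sum)
  then obtain i where "i \<in> A" "w \<in> Poly_Mapping.keys (f i)"
    by (metis in_keys_iff sum.neutral)
  then show "w \<in> W" using assms by blast
qed


text \<open>As the Taylor module is free, membership in the product can be tested coordinatewise: an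
  element with coordinates in the ideal is expanded along the basis
  \<open>wedge_basis\<close>.\<close>

lemma ideal_module_prod_taylor_module:
  "ideal_module_prod (graded_max_ideal n) (taylor_module n t q) =
    {f :: nat set \<Rightarrow> 'k::field mpoly. (\<forall>F. Poly_Mapping.keys (f F) \<subseteq> expos n - {0}) \<and>
      (\<forall>F. F \<notin> taylor_indices t q \<longrightarrow> f F = 0)}" (is "?L = ?R")
proof
  show "?L \<subseteq> ?R"
  proof
    fix f :: "nat set \<Rightarrow> 'k mpoly" assume "f \<in> ?L"
    then obtain N :: nat and a g where
      ag: "\<And>j. j < N \<Longrightarrow> Poly_Mapping.keys (a j) \<subseteq> expos n - {0} \<and> g j \<in> taylor_module n t q"
      and f: "f = (\<lambda>F. \<Sum>j<N. a j * g j F)"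
      by (auto simp: ideal_module_prod_def graded_max_ideal_eq)
    have term_keys: "Poly_Mapping.keys (a j * g j F) \<subseteq> expos n - {0}" if "j < N" for j F
    proof
      fix w assume "w \<in> Poly_Mapping.keys (a j * g j F)"
      then obtain x y where xy: "w = x + y" "x \<in> Poly_Mapping.keys (a j)"
        "y \<in> Poly_Mapping.keys (g j F)"
        using keys_mult[of "a j" "g j F"] by blast
      have x: "x \<in> expos n" "x \<noteq> 0" using ag[OF that] xy(2) by auto
      have "F \<in> taylor_indices t q"
        using xy(3) ag[OF that] by (force simp: taylor_module_def)
      then have "y \<in> expos n"
        using xy(3) ag[OF that] by (auto simp: taylor_module_def poly_ring_def)
      \<comment> \<open>Exponents are natural numbers, so a product of monomials is 1 only if both
        factors are.\<close>
      moreover have "x + y \<noteq> 0"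
      proof
        assume "x + y = 0"
        then have "Poly_Mapping.lookup x k + Poly_Mapping.lookup y k = 0" for k
          by (metis lookup_add lookup_zero)
        then have "x = 0" by (intro poly_mapping_eqI) simp
        then show False using x(2) by simp
      qed
      ultimately show "w \<in> expos n - {0}" using expos_add[OF x(1), of y] xy(1) by simp
    qed
    have "Poly_Mapping.keys (f F) \<subseteq> expos n - {0}" for F
      unfolding f by (rule keys_sum_subset, rule term_keys) simp
    moreover have "f F = 0" if "F \<notin> taylor_indices t q" for F
      unfolding f using ag that by (intro sum.neutral) (auto simp: taylor_module_def)
    ultimately show "f \<in> ?R" by blast
  qed
  show "?R \<subseteq> ?L"
  proof
    fix f assume f: "f \<in> ?R"
    let ?N = "card (taylor_indices t q)"
    \<comment> \<open>Numbering the index sets brings the basis expansion into the form of a sum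
      over \<open>j < N\<close>.\<close>
    obtain h where h: "bij_betw h {..<?N} (taylor_indices t q)"
      using ex_bij_betw_nat_finite[OF finite_taylor_indices[of t q]] atLeast0LessThan by metis
    have eq: "f = (\<lambda>F. \<Sum>j<?N. f (h j) * wedge_basis (h j) F)"
    proof
      fix F
      have "(\<Sum>j<?N. f (h j) * wedge_basis (h j) F) =
          (\<Sum>G\<in>taylor_indices t q. f G * wedge_basis G F)"
        by (rule sum.reindex_bij_betw[OF h, of "\<lambda>G. f G * wedge_basis G F"])
      also have "\<dots> = (\<Sum>G\<in>taylor_indices t q. if F = G then f G else 0)"
        by (rule sum.cong) (auto simp: wedge_basis_def)
      also have "\<dots> = f F"
        using f by (simp add: finite_taylor_indices)
      finally show "f F = (\<Sum>j<?N. f (h j) * wedge_basis (h j) F)" by simp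
    qed
    have mem: "f (h j) \<in> graded_max_ideal n \<and> wedge_basis (h j) \<in> taylor_module n t q"
      if "j < ?N" for j
    proof -
      have "h j \<in> taylor_indices t q"
        using h that by (auto simp: bij_betw_def)
      then show ?thesis
        using f by (auto simp: graded_max_ideal_eq taylor_module_def wedge_basis_def poly_ring_def expos_def)
    qed
    show "f \<in> ?L"
      unfolding ideal_module_prod_def
      by (intro CollectI exI[of _ ?N] exI[of _ "\<lambda>j. f (h j)"] exI[of _ "\<lambda>j. wedge_basis (h j)"]
        conjI[OF _ eq] allI impI mem)
  qed
qed

lemma ideal_graded_max_ideal: "ideal (graded_max_ideal n :: 'k::field mpoly set) (poly_ring n)"
proof -
  interpret cring "poly_ring n :: 'k mpoly ring" by (rule cring_poly_ring)
  show ?thesis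
    unfolding graded_max_ideal_def
    by (rule genideal_ideal) (auto simp: X_def poly_ring_def expos_def)
qed

section \<open>Quotients of lcms as coefficients of the differential\<close>

lemma lcm_expo_in_expos:
  assumes "finite A" "A \<noteq> {}" "A \<subseteq> expos n"
  shows "lcm_expo A \<in> expos n"
  unfolding expos_def
proof (intro CollectI subsetI)
  fix k assume "k \<in> Poly_Mapping.keys (lcm_expo A)"
  then have "Max ((\<lambda>w. Poly_Mapping.lookup w k) ` A) \<noteq> 0"
    using assms by (simp add: in_keys_iff lookup_lcm_expo)
  moreover have "Max ((\<lambda>w. Poly_Mapping.lookup w k) ` A) \<in> (\<lambda>w. Poly_Mapping.lookup w k) ` A"
    using assms by (intro Max_in) auto
  ultimately obtain w where "w \<in> A" "k \<in> Poly_Mapping.keys w"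
    by (auto simp: in_keys_iff)
  then show "k \<in> {1..n}" using assms(3) unfolding expos_def by blast
qed

text \<open>Both lcms are coordinatewise maxima over nonempty sets. The maximum at \<open>k\<close>
  drops on omitting \<open>u\<close> exactly if \<open>u\<close> alone attains it there.\<close>

lemma lcm_expo_diff_ne_0_iff:
  assumes "finite A" "u \<in> A" "A - {u} \<noteq> {}"
  shows "lcm_expo A - lcm_expo (A - {u}) \<noteq> 0 \<longleftrightarrow>
    (\<exists>k. \<forall>w\<in>A - {u}. Poly_Mapping.lookup w k < Poly_Mapping.lookup u k)"
proof -
  have "Poly_Mapping.lookup (lcm_expo A - lcm_expo (A - {u})) k \<noteq> 0 \<longleftrightarrow>
      (\<forall>w\<in>A - {u}. Poly_Mapping.lookup w k < Poly_Mapping.lookup u k)" for k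
  proof -
    let ?M = "Max ((\<lambda>w. Poly_Mapping.lookup w k) ` (A - {u}))"
    have "Max ((\<lambda>w. Poly_Mapping.lookup w k) ` insert u (A - {u})) =
        max (Poly_Mapping.lookup u k) ?M"
      using assms(1,3) by (simp del: insert_Diff_single)
    then have lcm: "Poly_Mapping.lookup (lcm_expo A) k = max (Poly_Mapping.lookup u k) ?M"
      using assms(1,2) by (subst lookup_lcm_expo) (auto simp: insert_absorb)
    have lcm': "Poly_Mapping.lookup (lcm_expo (A - {u})) k = ?M"
      using assms by (intro lookup_lcm_expo) auto
    have M: "?M < Poly_Mapping.lookup u k \<longleftrightarrow>
        (\<forall>w\<in>A - {u}. Poly_Mapping.lookup w k < Poly_Mapping.lookup u k)"
      using assms by (subst Max_less_iff) auto
    show ?thesis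
      unfolding lookup_minus lcm lcm' M[symmetric] by auto
  qed
  then show ?thesis
    by (metis lookup_zero poly_mapping_eqI)
qed

lemma taylor_diff_wedge_basis:
  assumes "F \<in> taylor_indices t q"
  shows "taylor_diff v t q (wedge_basis F) = taylor_diff_basis v F"
proof
  fix G
  have "taylor_diff v t q (wedge_basis F) G =
      (\<Sum>F'\<in>taylor_indices t q. if F' = F then taylor_diff_basis v F' G else 0)"
    unfolding taylor_diff_def by (intro sum.cong) (auto simp: wedge_basis_def)
  then show "taylor_diff v t q (wedge_basis F) G = taylor_diff_basis v F G"
    using assms finite_taylor_indices by simp
qed

text \<open>Only the summand omitting \<open>i\<close> contributes to this coordinate, and its sign
  does not affect the support.\<close>

lemma keys_taylor_diff_basis:
  assumes "finite F" "i \<in> F"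
  shows "Poly_Mapping.keys (taylor_diff_basis v F (F - {i}) :: 'k::field mpoly) =
    {lcm_expo (v ` F) - lcm_expo (v ` (F - {i}))}"
proof -
  let ?m = "monom (lcm_expo (v ` F) - lcm_expo (v ` (F - {i}))) :: 'k mpoly"
  have "taylor_diff_basis v F (F - {i}) =
      (\<Sum>j\<in>F. if j = i then (- 1) ^ card {j \<in> F. j < i} * ?m else 0)"
    unfolding taylor_diff_basis_def
    by (intro sum.cong) (use assms in \<open>auto simp: wedge_basis_def\<close>)
  also have "\<dots> = (- 1) ^ card {j \<in> F. j < i} * ?m"
    using assms by simp
  finally show ?thesis
    by (cases "even (card {j \<in> F. j < i})") auto
qed

text \<open>One direction needs only the basis element of top degree. For the other, a variable in
  which a generator exceeds all others also works within every subset, so no coefficient is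
  constant.\<close>

lemma taylor_resolution_minimal_iff_peaked:
  assumes inj: "inj_on v {1..t}" and expos: "v ` {1..t} \<subseteq> expos n"
  shows "taylor_resolution_minimal TYPE('k::field) n t v \<longleftrightarrow> peaked (v ` {1..t})"
proof
  assume minimal: "taylor_resolution_minimal TYPE('k) n t v"
  show "peaked (v ` {1..t})"
    unfolding peaked_def
  proof
    fix u assume "u \<in> v ` {1..t}"
    then obtain i where i: "i \<in> {1..t}" "u = v i" by blast
    show "\<exists>k. \<forall>w\<in>v ` {1..t} - {u}. Poly_Mapping.lookup w k < Poly_Mapping.lookup u k"
    proof (cases "v ` {1..t} - {u} = {}")
      case False
      \<comment> \<open>Degree \<open>q\<close> has index sets of size \<open>q + 1\<close>, so the
        full set \<open>{1..t}\<close> lives in degree \<open>t - 1\<close>, which must be at least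
        1 for minimality to speak about it.\<close>
      have t: "2 \<le> t"
      proof (rule ccontr)
        assume "\<not> 2 \<le> t"
        then have "{1..t} = {i}" using i by auto
        then show False using False i by simp
      qed
      have F: "{1..t} \<in> taylor_indices t (t - 1)"
        using t by (simp add: taylor_indices_def)
      have "wedge_basis {1..t} \<in> (taylor_module n t (t - 1) :: (nat set \<Rightarrow> 'k mpoly) set)"
        using F by (auto simp: taylor_module_def wedge_basis_def poly_ring_def expos_def)
      then have "(taylor_diff_basis v {1..t} :: nat set \<Rightarrow> 'k mpoly)
          \<in> ideal_module_prod (graded_max_ideal n) (taylor_module n t (t - 1 - 1))"
        using minimal t taylor_diff_wedge_basis[OF F, of v, where 'a='k]
        unfolding taylor_resolution_minimal_def by force
      then have "Poly_Mapping.keys (taylor_diff_basis v {1..t} ({1..t} - {i}) :: 'k mpoly)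
          \<subseteq> expos n - {0}"
        unfolding ideal_module_prod_taylor_module by blast
      then have "lcm_expo (v ` {1..t}) - lcm_expo (v ` ({1..t} - {i})) \<noteq> 0"
        using i by (simp add: keys_taylor_diff_basis)
      \<comment> \<open>By injectivity, omitting an index omits exactly one generator.\<close>
      moreover have "v ` ({1..t} - {i}) = v ` {1..t} - {u}"
        using inj_on_image_set_diff[OF inj, of "{1..t}" "{i}"] i by simp
      ultimately show ?thesis
        using lcm_expo_diff_ne_0_iff[of "v ` {1..t}" u] i False by simp
    next
      case True
      then show ?thesis by blast
    qed
  qed
next
  assume peaked: "peaked (v ` {1..t})"
  interpret R: cring "poly_ring n :: 'k mpoly ring" by (rule cring_poly_ring)
  interpret J: ideal "graded_max_ideal n :: 'k mpoly set" "poly_ring n"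
    by (rule ideal_graded_max_ideal)
  show "taylor_resolution_minimal TYPE('k) n t v"
    unfolding taylor_resolution_minimal_def
  proof (intro ballI subsetI)
    fix q and h :: "nat set \<Rightarrow> 'k mpoly"
    assume q: "q \<in> {1..t-1}" and "h \<in> taylor_diff v t q ` taylor_module n t q"
    then obtain f where f: "f \<in> taylor_module n t q" and h: "h = taylor_diff v t q f" by blast
    let ?c = "\<lambda>F i. lcm_expo (v ` F) - lcm_expo (v ` (F - {i}))"
    \<comment> \<open>The monomial is split off as a factor: it lies in the maximal ideal, which
      then absorbs the rest of the term.\<close>
    have h_eq: "h G = (\<Sum>F\<in>taylor_indices t q. \<Sum>i\<in>F.
        (f F * (- 1) ^ card {j \<in> F. j < i} * wedge_basis (F - {i}) G) * monom (?c F i))" for G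
      by (simp add: h taylor_diff_def taylor_diff_basis_def sum_distrib_left mult_ac)
    have "Poly_Mapping.keys (h G) \<subseteq> expos n - {0}" for G
      unfolding h_eq
    proof (intro keys_sum_subset)
      fix F i assume F: "F \<in> taylor_indices t q" and i: "i \<in> F"
      have sub: "F \<subseteq> {1..t}" and card: "card F = q + 1"
        using F by (auto simp: taylor_indices_def)
      then have fin: "finite F" by (meson finite_atLeastAtMost finite_subset)
      have img: "v ` (F - {i}) = v ` F - {v i}"
        using inj_on_image_set_diff[OF inj_on_subset[OF inj sub], of F "{i}"] i by simp
      have "card (F - {i}) = q" using card i fin by simp
      \<comment> \<open>Since \<open>q\<close> is at least 1, another generator remains for the
        comparison of lcms.\<close>
      then have "F - {i} \<noteq> {}" using q by force
      then have ne: "v ` F - {v i} \<noteq> {}" using img by blast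
      obtain k where "\<forall>w\<in>v ` {1..t} - {v i}. Poly_Mapping.lookup w k < Poly_Mapping.lookup (v i) k"
        using peaked sub i unfolding peaked_def by blast
      then have "\<forall>w\<in>v ` F - {v i}. Poly_Mapping.lookup w k < Poly_Mapping.lookup (v i) k"
        using sub by blast
      then have "?c F i \<noteq> 0"
        using lcm_expo_diff_ne_0_iff[of "v ` F" "v i"] fin i ne img by auto
      moreover have "lcm_expo (v ` F) \<in> expos n"
        using fin i sub expos by (intro lcm_expo_in_expos) auto
      ultimately have "monom (?c F i) \<in> (graded_max_ideal n :: 'k mpoly set)"
        by (simp add: graded_max_ideal_eq expos_diff)
      moreover have "f F * (- 1) ^ card {j \<in> F. j < i} * wedge_basis (F - {i}) G \<in> carrier (poly_ring n)"
      proof -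
        have "f F \<in> carrier (poly_ring n)" using f F by (auto simp: taylor_module_def)
        then show ?thesis
          by (cases "even (card {j \<in> F. j < i})") (auto simp: wedge_basis_def poly_ring_def)
      qed
      ultimately have "(f F * (- 1) ^ card {j \<in> F. j < i} * wedge_basis (F - {i}) G) * monom (?c F i)
          \<in> graded_max_ideal n"
        using J.I_l_closed by (fastforce simp: poly_ring_def)
      then show "Poly_Mapping.keys ((f F * (- 1) ^ card {j \<in> F. j < i} * wedge_basis (F - {i}) G)
          * monom (?c F i)) \<subseteq> expos n - {0}"
        unfolding graded_max_ideal_eq by blast
    qed
    moreover have "h G = 0" if G: "G \<notin> taylor_indices t (q - 1)" for G
      unfolding h_eq
    proof (intro sum.neutral ballI)
      fix F i assume "F \<in> taylor_indices t q" and "i \<in> F"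
      then have "F - {i} \<in> taylor_indices t (q - 1)"
        using q by (auto simp: taylor_indices_def)
      then have "wedge_basis (F - {i}) G = (0 :: 'k mpoly)"
        using G by (auto simp: wedge_basis_def)
      then show "f F * (- 1) ^ card {j \<in> F. j < i} * wedge_basis (F - {i}) G * monom (?c F i) = 0"
        by simp
    qed
    ultimately show "h \<in> ideal_module_prod (graded_max_ideal n) (taylor_module n t (q - 1))"
      unfolding ideal_module_prod_taylor_module by blast
  qed
qed

section \<open>Peaked generating sets of stable ideals\<close>

text \<open>The exponent vector of the generator \<open>u_i\<close> of the theorem; the same
  sequence \<open>a\<close> serves all \<open>i\<close>.\<close>

definition stair :: "(nat \<Rightarrow> nat) \<Rightarrow> nat \<Rightarrow> expo"
  where "stair a i = Poly_Mapping.single i 1 + (\<Sum>k=1..i. Poly_Mapping.single k (a k))"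

lemma lookup_stair:
  "Poly_Mapping.lookup (stair a i) k =
    (if k = i then 1 else 0) + (if 1 \<le> k \<and> k \<le> i then a k else 0)"
  by (auto simp: stair_def lookup_add lookup_sum lookup_single when_def)

lemma monom_stair: "(monom (stair a i) :: 'k::field mpoly) = X i * (\<Prod>k=1..i. X k ^ a k)"
proof -
  have pow: "X k ^ m = (monom (Poly_Mapping.single k m) :: 'k mpoly)" for k m
    by (induction m) (auto simp: X_def monom_def mult_single single_add[symmetric])
  have prod: "(\<Prod>k\<in>A. monom (f k) :: 'k mpoly) = monom (\<Sum>k\<in>A. f k)" for f :: "nat \<Rightarrow> expo" and A
    by (induction A rule: infinite_finite_induct) (auto simp: monom_def mult_single)
  show ?thesis
    by (simp only: stair_def monom_add pow prod) (simp add: X_def)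
qed

lemma stair_in_expos: "1 \<le> i \<Longrightarrow> i \<le> n \<Longrightarrow> stair a i \<in> expos n"
  by (auto simp: expos_def in_keys_iff lookup_stair split: if_splits)

text \<open>The peak of \<open>stair a i\<close> is at \<open>i\<close>, with exponent
  \<open>a i + 1\<close>; every other element has exponent \<open>a i\<close> or 0 there.\<close>

lemma peaked_stair: "peaked (stair a ` {1..r})"
  unfolding peaked_def
proof
  fix u assume "u \<in> stair a ` {1..r}"
  then obtain i where i: "i \<in> {1..r}" "u = stair a i" by blast
  have "\<forall>w\<in>stair a ` {1..r} - {u}. Poly_Mapping.lookup w i < Poly_Mapping.lookup u i"
  proof
    fix w assume "w \<in> stair a ` {1..r} - {u}"
    then obtain j where "w = stair a j" "j \<noteq> i" using i by blast
    then show "Poly_Mapping.lookup w i < Poly_Mapping.lookup u i"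
      using i by (simp add: lookup_stair)
  qed
  then show "\<exists>k. \<forall>w\<in>stair a ` {1..r} - {u}. Poly_Mapping.lookup w k < Poly_Mapping.lookup u k" ..
qed

section \<open>The last variables of the generators\<close>

lemma max_var_in_keys: "u \<noteq> 0 \<Longrightarrow> max_var u \<in> Poly_Mapping.keys u"
  unfolding max_var_def by (intro Max_in) auto

lemma le_max_var: "Poly_Mapping.lookup u k \<noteq> 0 \<Longrightarrow> k \<le> max_var u"
  unfolding max_var_def by (intro Max_ge) (auto simp: in_keys_iff)

text \<open>A converse to \<open>peaked_stair\<close> without polynomials: \<open>stable\<close>
  expresses the exchange property on generators only.\<close>

lemma peaked_stable_imp_stair:
  assumes expos: "G \<subseteq> expos n" and ne: "G \<noteq> {}" and zero: "0 \<notin> G" and peaked: "peaked G"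
    and stable: "\<And>u i. u \<in> G \<Longrightarrow> 1 \<le> i \<Longrightarrow> i < max_var u \<Longrightarrow>
      Poly_Mapping.single i 1 + u - Poly_Mapping.single (max_var u) 1 \<in> multiples n G"
  shows "\<exists>r a. 1 \<le> r \<and> r \<le> n \<and> G = stair a ` {1..r}"
proof -
  have keys: "max_var u \<in> Poly_Mapping.keys u" if "u \<in> G" for u
    using that zero by (intro max_var_in_keys) auto
  have pos: "0 < Poly_Mapping.lookup u (max_var u)" if "u \<in> G" for u
    using keys[OF that] by (simp add: in_keys_iff)
  have bounds: "1 \<le> max_var u" "max_var u \<le> n" if "u \<in> G" for u
  proof -
    have "max_var u \<in> {1..n}" using keys[OF that] expos that unfolding expos_def by blast
    then show "1 \<le> max_var u" "max_var u \<le> n" by auto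
  qed
  \<comment> \<open>A generator \<open>w\<close> dividing the exchanged monomial loses in the last
    variable of \<open>u\<close>. Without a gain at \<open>i\<close> it would divide
    \<open>u\<close>, hence equal \<open>u\<close>, contradicting that loss.\<close>
  have ex: "\<exists>w\<in>G. Poly_Mapping.lookup w i = Poly_Mapping.lookup u i + 1 \<and>
      (\<forall>k. k \<noteq> i \<longrightarrow> Poly_Mapping.lookup w k \<le> Poly_Mapping.lookup u k)"
    if u: "u \<in> G" and i: "1 \<le> i" "i < max_var u" for u i
  proof -
    let ?m = "max_var u"
    obtain w where w: "w \<in> G" and le: "\<And>k. Poly_Mapping.lookup w k \<le>
        Poly_Mapping.lookup (Poly_Mapping.single i 1 + u - Poly_Mapping.single ?m 1) k"
      using stable[OF u i] by (auto simp: multiples_def)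
    have m: "Poly_Mapping.lookup w ?m < Poly_Mapping.lookup u ?m"
      using le[of ?m] pos[OF u] i by (auto simp: lookup_add lookup_minus lookup_single)
    have other: "Poly_Mapping.lookup w k \<le> Poly_Mapping.lookup u k" if "k \<noteq> i" for k
      using le[of k] that by (auto simp: lookup_add lookup_minus lookup_single when_def split: if_splits)
    have wi: "Poly_Mapping.lookup w i \<le> Poly_Mapping.lookup u i + 1"
      using le[of i] i by (auto simp: lookup_add lookup_minus lookup_single when_def split: if_splits)
    have "\<not> Poly_Mapping.lookup w i \<le> Poly_Mapping.lookup u i"
    proof
      assume "Poly_Mapping.lookup w i \<le> Poly_Mapping.lookup u i"
      then have "\<forall>k. Poly_Mapping.lookup w k \<le> Poly_Mapping.lookup u k"
        using other by metis
      then have "w = u"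
        using peaked_imp_antichain[OF peaked] u w by (auto simp: antichain_def)
      then show False using m by simp
    qed
    then have "Poly_Mapping.lookup w i = Poly_Mapping.lookup u i + 1" using wi by simp
    then show ?thesis using w other by blast
  qed
  have peak: "\<forall>w\<in>G - {u}. Poly_Mapping.lookup w (max_var u) < Poly_Mapping.lookup u (max_var u)"
    if u: "u \<in> G" for u
  proof (cases "G - {u} = {}")
    case False
    obtain k where k: "\<forall>w\<in>G - {u}. Poly_Mapping.lookup w k < Poly_Mapping.lookup u k"
      using peaked u unfolding peaked_def by blast
    \<comment> \<open>Some other generator has a strictly smaller exponent, so \<open>u\<close>
      involves the variable \<open>k\<close>, and \<open>k\<close> is at most
      \<open>max_var u\<close>.\<close>
    then have k0: "Poly_Mapping.lookup u k \<noteq> 0" using False by fastforce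
    \<comment> \<open>Otherwise the exchange at \<open>k\<close> would give another generator with a
      larger exponent at \<open>k\<close>.\<close>
    have "\<not> k < max_var u"
    proof
      assume lt: "k < max_var u"
      have "k \<in> Poly_Mapping.keys u" using k0 by (simp add: in_keys_iff)
      then have "k \<in> {1..n}" using expos u unfolding expos_def by blast
      then have "1 \<le> k" by simp
      then obtain w where w: "w \<in> G" "Poly_Mapping.lookup w k = Poly_Mapping.lookup u k + 1"
        using ex[OF u _ lt] by blast
      then have "w \<in> G - {u}" by auto
      with k have "Poly_Mapping.lookup w k < Poly_Mapping.lookup u k" ..
      then show False using w(2) by simp
    qed
    then have "k = max_var u" using le_max_var[OF k0] by simp
    then show ?thesis using k by simp
  next
    case True
    then show ?thesis by blast
  qed
  \<comment> \<open>Two distinct generators with the same last variable would each exceed the other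
    in it.\<close>
  have inj: "u = w" if uw: "u \<in> G" "w \<in> G" "max_var u = max_var w" for u w
  proof (rule ccontr)
    assume "u \<noteq> w"
    then have "w \<in> G - {u}" "u \<in> G - {w}" using uw by auto
    then show False
      using peak[OF uw(1)] peak[OF uw(2)] uw(3) by (metis less_asym)
  qed
  have step: "\<exists>w\<in>G. max_var w = i \<and> Poly_Mapping.lookup w i = Poly_Mapping.lookup u i + 1 \<and>
      (\<forall>k. k \<noteq> i \<longrightarrow> Poly_Mapping.lookup w k \<le> Poly_Mapping.lookup u k)"
    if u: "u \<in> G" and i: "1 \<le> i" "i < max_var u" for u i
  proof -
    obtain w where w: "w \<in> G" "Poly_Mapping.lookup w i = Poly_Mapping.lookup u i + 1"
      "\<forall>k. k \<noteq> i \<longrightarrow> Poly_Mapping.lookup w k \<le> Poly_Mapping.lookup u k"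
      using ex[OF u i] by blast
    have "w \<noteq> u" using w(2) by auto
    then have "Poly_Mapping.lookup u (max_var w) < Poly_Mapping.lookup w (max_var w)"
      using peak[OF w(1)] u by blast
    \<comment> \<open>The generator \<open>w\<close> exceeds \<open>u\<close> at its own last
      variable, but can do so only at \<open>i\<close>.\<close>
    then have "max_var w = i" using w(3) leD by blast
    then show ?thesis using w by blast
  qed
  define r where "r = Max (max_var ` G)"
  have fin: "finite (max_var ` G)"
    by (rule finite_subset[of _ "{1..n}"]) (use bounds in auto)
  have "r \<in> max_var ` G" unfolding r_def using fin ne by (intro Max_in) auto
  then obtain u where u: "u \<in> G" "max_var u = r" by blast
  \<comment> \<open>From the generator with the largest last variable \<open>r\<close>, the exchange
    step reaches every smaller one.\<close>
  have image: "max_var ` G = {1..r}"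
  proof
    show "max_var ` G \<subseteq> {1..r}"
      using bounds fin by (auto simp: r_def)
    show "{1..r} \<subseteq> max_var ` G"
    proof
      fix i assume "i \<in> {1..r}"
      then show "i \<in> max_var ` G"
        using step[OF u(1), of i] u by (cases "i = r") force+
    qed
  qed
  \<comment> \<open>The generators are now enumerated by their last variables.\<close>
  define g where "g = inv_into G max_var"
  have g: "g i \<in> G" "max_var (g i) = i" if "i \<in> {1..r}" for i
    using that image by (auto simp: g_def inv_into_into f_inv_into_f)
  have g_max: "g (max_var w) = w" if "w \<in> G" for w
    using g[of "max_var w"] that image inj by blast
  \<comment> \<open>The truncated subtraction is harmless since \<open>g k\<close> involves \<open>X\<^sub>k\<close>.\<close>
  define a where "a k = Poly_Mapping.lookup (g k) k - 1" for k
  have stair: "g i = stair a i" if i: "i \<in> {1..r}" for i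
  proof (rule poly_mapping_eqI)
    fix k
    consider "k = 0" | "1 \<le> k" "k < i" | "k = i" | "i < k" by linarith
    then show "Poly_Mapping.lookup (g i) k = Poly_Mapping.lookup (stair a i) k"
    proof cases
      \<comment> \<open>The variables are numbered from 1, so index 0 carries no exponent.\<close>
      case 1
      have "Poly_Mapping.keys (g i) \<subseteq> {1..n}"
        using g(1)[OF i] expos unfolding expos_def by blast
      then have "k \<notin> Poly_Mapping.keys (g i)" using 1 by auto
      then show ?thesis using i 1 by (simp add: in_keys_iff lookup_stair)
    next
      case 2
      \<comment> \<open>By uniqueness this \<open>w\<close> is \<open>g k\<close>. Hence the
        exponent at \<open>k\<close> is the same in all \<open>g i\<close> with
        \<open>i > k\<close>, namely \<open>a k\<close>.\<close>
      then obtain w where "w \<in> G" "max_var w = k"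
        "Poly_Mapping.lookup w k = Poly_Mapping.lookup (g i) k + 1"
        using step[of "g i" k] g[OF i] by auto
      then have "Poly_Mapping.lookup (g k) k = Poly_Mapping.lookup (g i) k + 1"
        using g_max by metis
      then show ?thesis using 2 by (simp add: a_def lookup_stair)
    next
      case 3
      then show ?thesis using pos[OF g(1)[OF i]] g[OF i] i by (simp add: a_def lookup_stair)
    next
      case 4
      then have "Poly_Mapping.lookup (g i) k = 0"
        using le_max_var[of "g i" k] g(2)[OF i] by force
      then show ?thesis using 4 by (simp add: lookup_stair)
    qed
  qed
  have "G = g ` {1..r}"
    using g(1) g_max image by (auto simp: image_iff) (metis image_eqI)
  then have "G = stair a ` {1..r}" using stair by simp
  moreover have "1 \<le> r" "r \<le> n" using bounds[OF u(1)] u(2) by auto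
  ultimately show ?thesis by blast
qed

section \<open>Stable monomial ideals with minimal Taylor resolution\<close>

theorem theorem2p2:
  fixes I :: "'k::field mpoly set" and n t :: nat and v :: "nat \<Rightarrow> expo"
  assumes "monomial_ideal n I"
    and "I \<noteq> {0}"
    and "I \<noteq> carrier (poly_ring n)"
    and "stable_ideal n I"
    and "inj_on v {1..t}"
    and "minimal_monomial_generators n I (v ` {1..t})"
  shows "taylor_resolution_minimal TYPE('k) n t v \<longleftrightarrow>
    (\<exists>(r::nat) (a :: nat \<Rightarrow> nat). 1 \<le> r \<and> r \<le> n \<and>
      I = Idl\<^bsub>poly_ring n\<^esub> ((\<lambda>i. X i * (\<Prod>k=1..i. X k ^ a k)) ` {1..r}))"
proof -
  let ?G = "v ` {1..t}"
  have G: "?G \<subseteq> expos n" "Idl\<^bsub>poly_ring n\<^esub> (monom ` ?G) = I"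
    using assms(6) by (auto simp: minimal_monomial_generators_def)
  have I: "I = {p. Poly_Mapping.keys p \<subseteq> multiples n ?G}"
    using G Idl_monom[OF G(1), where 'k='k] by simp
  \<comment> \<open>An empty generating set would give the zero ideal, and the generator 1 the whole
    ring.\<close>
  have ne: "?G \<noteq> {}"
  proof
    assume "?G = {}"
    then have "I = {0}" using I by (auto simp: multiples_def)
    then show False using assms(2) by simp
  qed
  have zero: "0 \<notin> ?G"
  proof
    assume "0 \<in> ?G"
    then have "multiples n ?G = expos n" by (force simp: multiples_def)
    then have "I = carrier (poly_ring n)" using I by (simp add: poly_ring_def)
    then show False using assms(3) by simp
  qed
  have image: "(\<lambda>i. X i * (\<Prod>k=1..i. X k ^ a k)) ` {1..r} = (monom ` stair a ` {1..r} :: 'k mpoly set)"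
    for a r by (simp add: image_image monom_stair)
  have sub: "stair a ` {1..r} \<subseteq> expos n" if "r \<le> n" for a r
    using that stair_in_expos by fastforce
  have peaked_iff: "peaked ?G \<longleftrightarrow> (\<exists>r a. 1 \<le> r \<and> r \<le> n \<and> ?G = stair a ` {1..r})"
  proof
    assume "peaked ?G"
    moreover have "Poly_Mapping.single i 1 + u - Poly_Mapping.single (max_var u) 1 \<in> multiples n ?G"
      if "u \<in> ?G" "1 \<le> i" "i < max_var u" for u i
    proof -
      have "monom u \<in> I" "u \<in> expos n" "u \<noteq> 0"
        using I multiples_self[OF G(1) that(1)] that(1) G(1) zero by auto
      then have "monom (Poly_Mapping.single i 1 + u - Poly_Mapping.single (max_var u) 1) \<in> I"
        using assms(4) that(2,3) unfolding stable_ideal_def by blast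
      then show ?thesis using I by simp
    qed
    ultimately show "\<exists>r a. 1 \<le> r \<and> r \<le> n \<and> ?G = stair a ` {1..r}"
      using peaked_stable_imp_stair[OF G(1) ne zero] by blast
  qed (metis peaked_stair)
  \<comment> \<open>A staircase is peaked, hence an antichain. If it generates \<open>I\<close>, it
    is therefore the minimal generating set itself.\<close>
  have stair_iff: "?G = stair a ` {1..r} \<longleftrightarrow> I = Idl\<^bsub>poly_ring n\<^esub> (monom ` stair a ` {1..r})"
    if "r \<le> n" for a r
  proof
    assume "I = Idl\<^bsub>poly_ring n\<^esub> (monom ` stair a ` {1..r})"
    then have "multiples n ?G = multiples n (stair a ` {1..r})"
      using G(2) Idl_monom_eq_iff[OF G(1) sub[OF that, of a], where 'k='k] by simp
    then show "?G = stair a ` {1..r}"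
      by (rule antichain_eq_if_multiples_eq[OF antichain_minimal_monomial_generators[OF assms(6)]
        peaked_imp_antichain[OF peaked_stair] G(1) sub[OF that]])
  qed (use G(2) in simp)
  show ?thesis
    unfolding taylor_resolution_minimal_iff_peaked[OF assms(5) G(1)] image peaked_iff
    by (intro ex_cong1 conj_cong refl stair_iff)
qed

end
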